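(* In the setting described in the context, assume that $\nabla\mathcal R^*$ has the form $$\nabla\mathcal R^*(\psi)(x)=\phi_0(x)\,\nabla\mathcal R_0^*(\psi(x))+\phi_1(x),$$ where $\phi_0\in L^\infty(\Omega_d)$ with $\phi_0(x)\ge\underline{\phi_0}>0$ a.e., $\phi_1\in Q$, and $$\mathcal R_0^*(\psi)-\nu_1|\psi|\ge c_1\quad\text{for all }\psi\in L^\infty(\Omega_d;\mathbb R^m)$$ for some $\nu_1\ge0$ and $c_1\in\mathbb R$. Further, assume that $\psi_h^0$ is selected so that $\|B'\psi_h^0\|_{V'}\lesssim1$. Then there exists a constant $C_{\mathrm{stab}}$, independent of $h$, $\ell$ and $\{\alpha_k\}_{k=2,3,\dots}$, such that $$\nu\|u_h^\ell\|_V+\|\lambda_h^\ell\|_{Q'}+\frac{\|\psi_h^\ell\|_{Q'}+\nu_1\underline{\phi_0}\|\psi_h^\ell\|_{L^1(\Omega_d)}}{\sum_{k=1}^\ell\alpha_k}\le C_{\mathrm{stab}}\quad\text{for all }\ell\ge1\text{ and }h>0.$$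
   Context: Setting. $\Omega\subset\mathbb R^n$ ($n\in\{1,2,3\}$) is an open bounded polygonal/polyhedral domain. $\Omega_d\subset\overline\Omega$ is a Hausdorff-measurable set of Hausdorff dimension $d\le n$ with Hausdorff measure $\mathcal H_d$ (coinciding with the induced surface measure), and $(\cdot,\cdot)_{\Omega_d}$ is the $L^2(\Omega_d)$ inner product. $V$ is a real Hilbert space with dual $V'$ and duality pairing $\langle\cdot,\cdot\rangle$; $B:V\to Q$ is a surjective bounded linear map whose image $Q$ (a Hilbert space) is continuously and densely embedded in $L^2(\Omega_d;\mathbb R^m)$; $B':Q'\to V'$ is its adjoint. For a.e. $x\in\Omega_d$, $C(x)\subset\mathbb R^m$ is a closed convex set with nonempty interior. Set $\mathcal O=\{o\in L^2(\Omega_d;\mathbb R^m): o(x)\in C(x)\text{ for a.e. }x\in\Omega_d\}$. The bilinear form $a$ on $V$ is symmetric with $a(u,u)\ge\nu\|u\|_V^2$ and $a(u,v)\le M\|u\|_V\|v\|_V$ for constants $\nu,M>0$; $F\in V'$. Let $W=L^\infty(\Omega_d;\mathbb R^m)$, regarded as a subset of $Q'$ via $\langle w,q\rangle=(w,q)_{\Omega_d}$, and $b(v,w)=(Bv,w)_{\Omega_d}$. The notation $a\lesssim b$ means $a\le cb$ with $c$ independent of the mesh size $h$ and of the proximity parameters. Legendre function. A function $L:\mathbb R^m\to\mathbb R\cup\{+\infty\}$ is Legendre if it is proper with $\operatorname{int}(\operatorname{dom}L)\ne\emptyset$, strictly convex and differentiable on $\operatorname{int}(\operatorname{dom}L)$,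 with singular gradient on the boundary of $\operatorname{dom}L$. Let $R:\Omega_d\times\mathbb R^m\to\mathbb R\cup\{+\infty\}$ be Carathéodory with $R(x,\cdot)$ Legendre, $\operatorname{dom}R(x,\cdot)=C(x)$, and $R(x,y)/|y|\to\infty$ as $|y|\to\infty$, for a.e. $x$. Put $\mathcal R(w)(x)=R(x,w(x))$ and assume $\mathcal R:\mathcal O\to L^1(\Omega_d)$ is continuous ($\mathcal O$ with the $L^2$ topology). Let $R^*(x,z)=\sup_{y\in\mathbb R^m}\{z\cdot y-R(x,y)\}$ and $\nabla\mathcal R^*(\psi)(x)=\partial_zR^*(x,\psi(x))$; then $\nabla\mathcal R^*:W\to\mathcal O$ is continuous. In the claim, $\mathcal R_0^*:\mathbb R^m\to\mathbb R$ is a differentiable (convex) function with gradient $\nabla\mathcal R_0^*$, applied pointwise to $\psi$, and the lower bound on $\mathcal R_0^*(\psi)$ is understood pointwise. Discrete spaces and iterates. $V_h\subset V$ and $W_h\subset W$ are finite-dimensional subspaces (depending on a mesh size $h$) satisfying $\inf_{w\in W_h}\sup_{v\in V_h}\frac{b(v,w)}{\|v\|_V\|w\|_{Q'}}=\beta_h>\beta_0>0$ with $\beta_0$ mesh-independent, with a Fortin operator: a continuous linear map $\Pi_h:V\to V_h$ with $\|\Pi_hv\|_V\lesssim\|v\|_V$ and $b(v-\Pi_hv,w_h)=0$ for all $v\in V$, $w_h\in W_h$. Given $\psi_h^0\in W_h$ and positive parameters $\{\alpha_k\}$ with $\sum_k\alpha_k=\infty$, the proximal Galerkin iterates $(u_h^k,\psi_h^k)\in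 V_h\times W_h$, $k\ge1$, are the (unique) solutions of $$\alpha_k a(u_h^k,v_h)+b(v_h,\psi_h^k-\psi_h^{k-1})=\alpha_kF(v_h)\ \ \forall v_h\in V_h,\qquad b(u_h^k,w_h)-(\nabla\mathcal R^*(\psi_h^k),w_h)_{\Omega_d}=0\ \ \forall w_h\in W_h,$$ and $\lambda_h^k=(\psi_h^{k-1}-\psi_h^k)/\alpha_k$. *)

theory Defs
  imports "HOL-Probability.Essential_Supremum"
begin

section \<open>Hausdorff measure and dimension\<close>

text \<open>
  The factor \<^term>\<open>unit_ball_vol d / 2 powr d\<close> normalises the measure so that, for an integer
  \<^term>\<open>d\<close>, it is the usual surface measure on \<^term>\<open>d\<close>-dimensional surfaces.  The
  case \<^term>\<open>d = 0\<close> is separate because \<^prop>\<open>0 powr (0::real) = 0\<close>.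
\<close>

definition hausdorff_gauge :: "real \<Rightarrow> 'a::metric_space set \<Rightarrow> ennreal" where
  "hausdorff_gauge d U =
     (if U = {} then 0 else if d = 0 then 1
      else ennreal (unit_ball_vol d * (diameter U / 2) powr d))"

definition hausdorff_content :: "real \<Rightarrow> real \<Rightarrow> 'a::metric_space set \<Rightarrow> ennreal" where
  "hausdorff_content d \<delta> A =
     (INF U \<in> {U :: nat \<Rightarrow> 'a set. A \<subseteq> (\<Union>i. U i) \<and> (\<forall>i. bounded (U i) \<and> diameter (U i) \<le> \<delta>)}.
        \<Sum>i. hausdorff_gauge d (U i))"

definition hausdorff_outer :: "real \<Rightarrow> 'a::metric_space set \<Rightarrow> ennreal" where
  "hausdorff_outer d A = (SUP \<delta>\<in>{0<..}. hausdorff_content d \<delta> A)"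

definition hausdorff_measure :: "real \<Rightarrow> 'a::metric_space measure" where
  "hausdorff_measure d =
     measure_of UNIV (lambda_system UNIV UNIV (hausdorff_outer d)) (hausdorff_outer d)"

definition hausdorff_dim :: "'a::metric_space set \<Rightarrow> real" where
  "hausdorff_dim A = Inf {s. 0 \<le> s \<and> hausdorff_outer s A = 0}"

lemma hausdorff_content_empty: "0 < \<delta> \<Longrightarrow> hausdorff_content d \<delta> {} = 0"
  unfolding hausdorff_content_def
  by (intro antisym INF_lower2[of "\<lambda>_. {}"]) (auto simp: hausdorff_gauge_def)

lemma hausdorff_content_mono: "A \<subseteq> B \<Longrightarrow> hausdorff_content d \<delta> A \<le> hausdorff_content d \<delta> B"
  unfolding hausdorff_content_def by (rule INF_superset_mono) auto

lemma hausdorff_content_UN: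
  fixes A :: "nat \<Rightarrow> 'a::metric_space set"
  shows "hausdorff_content d \<delta> (\<Union>i. A i) \<le> (\<Sum>n. hausdorff_content d \<delta> (A n))"
proof (rule ennreal_le_epsilon)
  fix e :: real assume e: "0 < e" and "(\<Sum>n. hausdorff_content d \<delta> (A n)) < top"
  then have "hausdorff_content d \<delta> (A n) < hausdorff_content d \<delta> (A n) + e * (1/2)^Suc n" for n
    by (auto simp add: less_top dest!: ennreal_suminf_lessD)
  then have "\<exists>U. A n \<subseteq> (\<Union>i. U i) \<and> (\<forall>i. bounded (U i) \<and> diameter (U i) \<le> \<delta>) \<and>
      (\<Sum>i. hausdorff_gauge d (U i)) < hausdorff_content d \<delta> (A n) + e * (1/2)^Suc n"
    (is "\<exists>U. ?P n U") for n
    unfolding hausdorff_content_def INF_less_iff by blast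
  then obtain B where B: "\<And>n. ?P n (B n)"
    by metis
  define C where "C = case_prod B o prod_decode"
  have "(\<Union>i. A i) \<subseteq> (\<Union>i. C i)"
    using B by (auto simp add: C_def subset_eq) (metis prod.case prod_encode_inverse)
  moreover have "\<forall>i. bounded (C i) \<and> diameter (C i) \<le> \<delta>"
    using B by (auto simp: C_def split_def)
  ultimately have "hausdorff_content d \<delta> (\<Union>i. A i) \<le> (\<Sum>i. hausdorff_gauge d (C i))"
    unfolding hausdorff_content_def by (intro INF_lower) blast
  also have "\<dots> = (\<Sum>n. \<Sum>i. hausdorff_gauge d (B n i))"
    unfolding C_def comp_def by (intro suminf_ennreal_2dimen) auto
  also have "\<dots> \<le> (\<Sum>n. hausdorff_content d \<delta> (A n) + e * (1/2) ^ Suc n)"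
    using B by (intro suminf_le allI) (auto intro: less_imp_le)
  also have "\<dots> = (\<Sum>n. hausdorff_content d \<delta> (A n)) + (\<Sum>n. ennreal e * ennreal ((1/2) ^ Suc n))"
    using e by (subst suminf_add[symmetric])
      (auto simp del: ennreal_suminf_cmult simp add: ennreal_mult[symmetric])
  also have "\<dots> = (\<Sum>n. hausdorff_content d \<delta> (A n)) + e"
    unfolding ennreal_suminf_cmult
    by (subst suminf_ennreal_eq[OF zero_le_power power_half_series]) auto
  finally show "hausdorff_content d \<delta> (\<Union>i. A i) \<le> (\<Sum>n. hausdorff_content d \<delta> (A n)) + e" .
qed

lemma outer_measure_space_hausdorff:
  "outer_measure_space UNIV (hausdorff_outer d :: 'a::metric_space set \<Rightarrow> ennreal)"
  unfolding outer_measure_space_def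
proof (intro conjI)
  show "positive UNIV (hausdorff_outer d :: 'a set \<Rightarrow> ennreal)"
    by (auto simp: positive_def hausdorff_outer_def hausdorff_content_empty)
  show "increasing UNIV (hausdorff_outer d :: 'a set \<Rightarrow> ennreal)"
    by (auto simp: increasing_def hausdorff_outer_def intro!: SUP_mono' hausdorff_content_mono)
  show "countably_subadditive UNIV (hausdorff_outer d :: 'a set \<Rightarrow> ennreal)"
    unfolding countably_subadditive_def
  proof (intro allI impI)
    fix A :: "nat \<Rightarrow> 'a set"
    show "hausdorff_outer d (\<Union>i. A i) \<le> (\<Sum>i. hausdorff_outer d (A i))"
      unfolding hausdorff_outer_def[of d "\<Union>i. A i"]
    proof (rule SUP_least)
      fix \<delta> :: real assume "\<delta> \<in> {0<..}"
      then have "(\<Sum>n. hausdorff_content d \<delta> (A n)) \<le> (\<Sum>i. hausdorff_outer d (A i))"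
        by (intro suminf_le allI) (auto simp: hausdorff_outer_def intro: SUP_upper)
      with hausdorff_content_UN show "hausdorff_content d \<delta> (\<Union>i. A i) \<le> (\<Sum>i. hausdorff_outer d (A i))"
        by (rule order_trans)
    qed
  qed
qed

lemma
  fixes A :: "'a::metric_space set"
  shows sets_hausdorff_measure:
      "sets (hausdorff_measure d :: 'a measure) = lambda_system UNIV UNIV (hausdorff_outer d)"
    and emeasure_hausdorff_measure:
      "A \<in> sets (hausdorff_measure d) \<Longrightarrow> emeasure (hausdorff_measure d) A = hausdorff_outer d A"
proof -
  have ms: "measure_space UNIV (lambda_system UNIV UNIV (hausdorff_outer d))
      (hausdorff_outer d :: 'a set \<Rightarrow> ennreal)"
    using sigma_algebra.caratheodory_lemma[OF sigma_algebra_Pow, of UNIV, simplified,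
        OF outer_measure_space_hausdorff] .
  then have "sigma_algebra UNIV (lambda_system UNIV UNIV (hausdorff_outer d :: 'a set \<Rightarrow> ennreal))"
    by (simp add: measure_space_def)
  then show sets: "sets (hausdorff_measure d :: 'a measure) = lambda_system UNIV UNIV (hausdorff_outer d)"
    unfolding hausdorff_measure_def by (rule sigma_algebra.sets_measure_of_eq)
  show "A \<in> sets (hausdorff_measure d) \<Longrightarrow> emeasure (hausdorff_measure d) A = hausdorff_outer d A"
    using ms unfolding sets unfolding hausdorff_measure_def measure_space_def
    by (elim conjE) (rule emeasure_measure_of_sigma)
qed


section \<open>Polyhedral domains\<close>

definition polyhedral_domain :: "'a::euclidean_space set \<Rightarrow> bool" where
  "polyhedral_domain \<Omega> \<longleftrightarrow> open \<Omega> \<and> bounded \<Omega> \<and> connected \<Omega> \<and> \<Omega> \<noteq> {} \<and>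
     (\<exists>\<F>. finite \<F> \<and> (\<forall>P\<in>\<F>. polytope P \<and> aff_dim P = int DIM('a) - 1) \<and> frontier \<Omega> = \<Union>\<F>)"


section \<open>Lebesgue spaces\<close>

text \<open>
  Elements of the Lebesgue spaces are represented by functions.  Equality in these spaces
  is equality almost everywhere.
\<close>

definition L1_norm :: "'a measure \<Rightarrow> ('a \<Rightarrow> 'b::euclidean_space) \<Rightarrow> real" where
  "L1_norm \<mu> f = (LINT x|\<mu>. norm (f x))"

definition L1_space :: "'a measure \<Rightarrow> ('a \<Rightarrow> 'b::euclidean_space) set" where
  "L1_space \<mu> = {f. integrable \<mu> f}"

definition L2_norm :: "'a measure \<Rightarrow> ('a \<Rightarrow> 'b::euclidean_space) \<Rightarrow> real" where
  "L2_norm \<mu> f = sqrt (LINT x|\<mu>. (norm (f x))\<^sup>2)"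

definition L2_space :: "'a measure \<Rightarrow> ('a \<Rightarrow> 'b::euclidean_space) set" where
  "L2_space \<mu> = {f \<in> borel_measurable \<mu>. integrable \<mu> (\<lambda>x. (norm (f x))\<^sup>2)}"

definition L2_inner :: "'a measure \<Rightarrow> ('a \<Rightarrow> 'b::euclidean_space) \<Rightarrow> ('a \<Rightarrow> 'b) \<Rightarrow> real" where
  "L2_inner \<mu> f g = (LINT x|\<mu>. f x \<bullet> g x)"

definition Linf_norm :: "'a measure \<Rightarrow> ('a \<Rightarrow> 'b::euclidean_space) \<Rightarrow> real" where
  "Linf_norm \<mu> f = real_of_ereal (esssup \<mu> (\<lambda>x. ereal (norm (f x))))"

definition Linf_space :: "'a measure \<Rightarrow> ('a \<Rightarrow> 'b::euclidean_space) set" where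
  "Linf_space \<mu> = {f \<in> borel_measurable \<mu>. esssup \<mu> (\<lambda>x. ereal (norm (f x))) < \<infinity>}"

definition continuous_map_between ::
  "('f \<Rightarrow> 'f \<Rightarrow> real) \<Rightarrow> 'f set \<Rightarrow> ('g \<Rightarrow> 'g \<Rightarrow> real) \<Rightarrow> 'g set \<Rightarrow> ('f \<Rightarrow> 'g) \<Rightarrow> bool" where
  "continuous_map_between dS S dT T \<Phi> \<longleftrightarrow>
     \<Phi> \<in> S \<rightarrow> T \<and>
     (\<forall>f\<in>S. \<forall>\<epsilon>>0. \<exists>\<delta>>0. \<forall>g\<in>S. dS g f < \<delta> \<longrightarrow> dT (\<Phi> g) (\<Phi> f) < \<epsilon>)"

text \<open>
  The Hilbert space \<open>Q\<close> is the type \<^typ>\<open>'q\<close>.  The map \<^term>\<open>\<iota>\<close> sends an element of \<open>Q\<close> to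
  (a representative of) its image in \<open>L\<^sup>2\<close>.
\<close>

definition dense_embedding_L2 ::
  "'a measure \<Rightarrow> ('q::real_normed_vector \<Rightarrow> 'a \<Rightarrow> 'b::euclidean_space) \<Rightarrow> bool" where
  "dense_embedding_L2 \<mu> \<iota> \<longleftrightarrow>
     (\<forall>q. \<iota> q \<in> L2_space \<mu>) \<and>
     (\<forall>p q. AE x in \<mu>. \<iota> (p + q) x = \<iota> p x + \<iota> q x) \<and>
     (\<forall>c q. AE x in \<mu>. \<iota> (c *\<^sub>R q) x = c *\<^sub>R \<iota> q x) \<and>
     (\<forall>q. (AE x in \<mu>. \<iota> q x = 0) \<longrightarrow> q = 0) \<and>
     (\<exists>K. \<forall>q. L2_norm \<mu> (\<iota> q) \<le> K * norm q) \<and>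
     (\<forall>f\<in>L2_space \<mu>. \<forall>\<epsilon>>0. \<exists>q. L2_norm \<mu> (\<lambda>x. f x - \<iota> q x) < \<epsilon>)"

text \<open>
  The dual space of \<open>Q\<close> is \<^typ>\<open>'q \<Rightarrow>\<^sub>L real\<close>, with its operator norm.
\<close>

definition is_functional_on ::
  "'a measure \<Rightarrow> ('q::real_normed_vector \<Rightarrow> 'a \<Rightarrow> 'b::euclidean_space) \<Rightarrow> ('a \<Rightarrow> 'b) \<Rightarrow> bool" where
  "is_functional_on \<mu> \<iota> w \<longleftrightarrow>
     (\<forall>q. integrable \<mu> (\<lambda>x. w x \<bullet> \<iota> q x)) \<and> bounded_linear (\<lambda>q. L2_inner \<mu> w (\<iota> q))"

definition to_dual ::
  "'a measure \<Rightarrow> ('q::real_normed_vector \<Rightarrow> 'a \<Rightarrow> 'b::euclidean_space) \<Rightarrow> ('a \<Rightarrow> 'b) \<Rightarrow> 'q \<Rightarrow>\<^sub>L real" where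
  "to_dual \<mu> \<iota> w = Blinfun (\<lambda>q. L2_inner \<mu> w (\<iota> q))"

definition dual_adjoint ::
  "('v::real_normed_vector \<Rightarrow>\<^sub>L 'q::real_normed_vector) \<Rightarrow> ('q \<Rightarrow>\<^sub>L real) \<Rightarrow> 'v \<Rightarrow>\<^sub>L real" where
  "dual_adjoint B g = g o\<^sub>L B"

definition bform ::
  "'a measure \<Rightarrow> ('q::real_normed_vector \<Rightarrow> 'a \<Rightarrow> 'b::euclidean_space) \<Rightarrow>
   ('v::real_normed_vector \<Rightarrow>\<^sub>L 'q) \<Rightarrow> 'v \<Rightarrow> ('a \<Rightarrow> 'b) \<Rightarrow> real" where
  "bform \<mu> \<iota> B v w = L2_inner \<mu> (\<iota> (blinfun_apply B v)) w"


section \<open>Legendre functions and conjugates\<close>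

definition gradient :: "('b::real_inner \<Rightarrow> real) \<Rightarrow> 'b \<Rightarrow> 'b" where
  "gradient f x = (THE D. GDERIV f x :> D)"

definition edom :: "('b \<Rightarrow> ereal) \<Rightarrow> 'b set" where
  "edom L = {y. L y < \<infinity>}"

definition strictly_convex_on :: "'b::real_vector set \<Rightarrow> ('b \<Rightarrow> real) \<Rightarrow> bool" where
  "strictly_convex_on S f \<longleftrightarrow> convex S \<and>
     (\<forall>x\<in>S. \<forall>y\<in>S. \<forall>t. x \<noteq> y \<and> 0 < t \<and> t < 1 \<longrightarrow>
        f ((1 - t) *\<^sub>R x + t *\<^sub>R y) < (1 - t) * f x + t * f y)"

definition Legendre_function :: "('b::euclidean_space \<Rightarrow> ereal) \<Rightarrow> bool" where
  "Legendre_function L \<longleftrightarrow>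
     (\<forall>y. L y \<noteq> -\<infinity>) \<and> edom L \<noteq> {} \<and> interior (edom L) \<noteq> {} \<and>
     strictly_convex_on (interior (edom L)) (\<lambda>y. real_of_ereal (L y)) \<and>
     (\<forall>y\<in>interior (edom L). (\<lambda>y. real_of_ereal (L y)) differentiable (at y)) \<and>
     (\<forall>s y. (\<forall>k::nat. s k \<in> interior (edom L)) \<and> s \<longlonglongrightarrow> y \<and> y \<in> frontier (edom L) \<longrightarrow>
        filterlim (\<lambda>k. norm (gradient (\<lambda>y. real_of_ereal (L y)) (s k))) at_top sequentially)"

text \<open>
  A function that is finite exactly on the closed set \<^term>\<open>C x\<close> cannot be continuous as an
  extended-real function at a boundary point of \<^term>\<open>C x\<close>, so continuity in the second argument
  is continuity on \<^term>\<open>C x\<close>.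
\<close>

definition Caratheodory_on ::
  "'a measure \<Rightarrow> ('a \<Rightarrow> 'b::euclidean_space set) \<Rightarrow> ('a \<Rightarrow> 'b \<Rightarrow> ereal) \<Rightarrow> bool" where
  "Caratheodory_on \<mu> C R \<longleftrightarrow>
     (\<forall>y. (\<lambda>x. R x y) \<in> borel_measurable \<mu>) \<and> (AE x in \<mu>. continuous_on (C x) (R x))"

definition conjugate_function :: "('b::euclidean_space \<Rightarrow> ereal) \<Rightarrow> 'b \<Rightarrow> ereal" where
  "conjugate_function L z = (SUP y. ereal (z \<bullet> y) - L y)"

definition grad_conjugate ::
  "('a \<Rightarrow> 'b::euclidean_space \<Rightarrow> ereal) \<Rightarrow> ('a \<Rightarrow> 'b) \<Rightarrow> 'a \<Rightarrow> 'b" where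
  "grad_conjugate R \<psi> x = gradient (\<lambda>z. real_of_ereal (conjugate_function (R x) z)) (\<psi> x)"

definition superposition :: "('a \<Rightarrow> 'b \<Rightarrow> ereal) \<Rightarrow> ('a \<Rightarrow> 'b) \<Rightarrow> 'a \<Rightarrow> real" where
  "superposition R w x = real_of_ereal (R x (w x))"

definition admissible_set ::
  "'a measure \<Rightarrow> ('a \<Rightarrow> 'b::euclidean_space set) \<Rightarrow> ('a \<Rightarrow> 'b) set" where
  "admissible_set \<mu> C = {w \<in> L2_space \<mu>. AE x in \<mu>. w x \<in> C x}"


section \<open>Discrete spaces and proximal Galerkin iterates\<close>

definition finite_dim_subspace :: "'v::real_vector set \<Rightarrow> bool" where
  "finite_dim_subspace S \<longleftrightarrow> (\<exists>E. finite E \<and> S = span E)"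

text \<open>
  A subspace of \<open>L\<^sup>\<infinity>\<close>, as a set of representatives, is closed under equality almost everywhere.
\<close>

definition finite_dim_subspace_Linf ::
  "'a measure \<Rightarrow> ('a \<Rightarrow> 'b::euclidean_space) set \<Rightarrow> bool" where
  "finite_dim_subspace_Linf \<mu> S \<longleftrightarrow>
     (\<exists>(N::nat) e. (\<forall>i<N. e i \<in> Linf_space \<mu>) \<and>
        S = {w \<in> Linf_space \<mu>. \<exists>c. AE x in \<mu>. w x = (\<Sum>i<N. c i *\<^sub>R e i x)})"

text \<open>
  The infimum and supremum are over nonzero elements.  They are taken in \<^typ>\<open>ereal\<close>, so that
  the infimum is \<^term>\<open>\<infinity>::ereal\<close> if \<^term>\<open>W\<close> is trivial.
\<close>

definition inf_sup_constant ::
  "'a measure \<Rightarrow> ('q::real_normed_vector \<Rightarrow> 'a \<Rightarrow> 'b::euclidean_space) \<Rightarrow>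
   ('v::real_normed_vector \<Rightarrow>\<^sub>L 'q) \<Rightarrow> 'v set \<Rightarrow> ('a \<Rightarrow> 'b) set \<Rightarrow> ereal" where
  "inf_sup_constant \<mu> \<iota> B V W =
     (INF w \<in> {w \<in> W. \<not> (AE x in \<mu>. w x = 0)}. SUP v \<in> V - {0}.
        ereal (bform \<mu> \<iota> B v w / (norm v * norm (to_dual \<mu> \<iota> w))))"

definition Fortin_operator ::
  "'a measure \<Rightarrow> ('q::real_normed_vector \<Rightarrow> 'a \<Rightarrow> 'b::euclidean_space) \<Rightarrow>
   ('v::real_normed_vector \<Rightarrow>\<^sub>L 'q) \<Rightarrow> 'v set \<Rightarrow> ('a \<Rightarrow> 'b) set \<Rightarrow> real \<Rightarrow> ('v \<Rightarrow> 'v) \<Rightarrow> bool" where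
  "Fortin_operator \<mu> \<iota> B V W c P \<longleftrightarrow>
     bounded_linear P \<and> range P \<subseteq> V \<and> (\<forall>v. norm (P v) \<le> c * norm v) \<and>
     (\<forall>v. \<forall>w\<in>W. bform \<mu> \<iota> B (v - P v) w = 0)"

text \<open>
  The iterates are indexed by \<open>k \<ge> 1\<close>.  The value \<^term>\<open>\<psi> 0\<close> is the initial guess, and
  \<^term>\<open>u 0\<close> and \<^term>\<open>\<alpha> 0\<close> play no role.
\<close>

definition proximal_Galerkin_iterates ::
  "'a measure \<Rightarrow> ('q::real_normed_vector \<Rightarrow> 'a \<Rightarrow> 'b::euclidean_space) \<Rightarrow>
   ('v::real_normed_vector \<Rightarrow>\<^sub>L 'q) \<Rightarrow> ('v \<Rightarrow> 'v \<Rightarrow> real) \<Rightarrow> ('v \<Rightarrow>\<^sub>L real) \<Rightarrow>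
   ('a \<Rightarrow> 'b \<Rightarrow> ereal) \<Rightarrow> 'v set \<Rightarrow> ('a \<Rightarrow> 'b) set \<Rightarrow> (nat \<Rightarrow> real) \<Rightarrow>
   (nat \<Rightarrow> 'v) \<Rightarrow> (nat \<Rightarrow> 'a \<Rightarrow> 'b) \<Rightarrow> bool" where
  "proximal_Galerkin_iterates \<mu> \<iota> B a F R V W \<alpha> u \<psi> \<longleftrightarrow>
     \<psi> 0 \<in> W \<and>
     (\<forall>k\<ge>1. u k \<in> V \<and> \<psi> k \<in> W \<and>
        (\<forall>v\<in>V. \<alpha> k * a (u k) v + bform \<mu> \<iota> B v (\<lambda>x. \<psi> k x - \<psi> (k - 1) x)
                 = \<alpha> k * blinfun_apply F v) \<and>
        (\<forall>w\<in>W. bform \<mu> \<iota> B (u k) w - L2_inner \<mu> (grad_conjugate R (\<psi> k)) w = 0))"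

definition multiplier ::
  "(nat \<Rightarrow> real) \<Rightarrow> (nat \<Rightarrow> 'a \<Rightarrow> 'b::real_vector) \<Rightarrow> nat \<Rightarrow> 'a \<Rightarrow> 'b" where
  "multiplier \<alpha> \<psi> k x = (1 / \<alpha> k) *\<^sub>R (\<psi> (k - 1) x - \<psi> k x)"

end

theory Submission
  imports Defs
begin

text \<open>
  Let \<open>v\<^sub>1\<close> be a preimage of \<open>\<phi>\<^sub>1\<close> under \<open>B\<close> and \<open>p = \<Pi>\<^sub>h v\<^sub>1\<close>.  Convexity and the growth of \<open>R\<^sub>0\<^sup>*\<close> give
  \<open>b(u\<^sup>k - p, \<psi>\<^sup>k) \<ge> \<nu>\<^sub>1 m \<parallel>\<psi>\<^sup>k\<parallel> - K\<close>, where \<open>m\<close> is the lower bound of \<open>\<phi>\<^sub>0\<close> and the norm is that of \<open>L\<^sup>1\<close>.  Testing the first step with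
  \<open>u\<^sup>1 - p\<close> therefore bounds \<open>u\<^sup>1\<close>.  Testing step \<open>k \<ge> 2\<close> with \<open>u\<^sup>k - u\<^sup>k\<^sup>-\<^sup>1\<close> and using the
  monotonicity of \<open>\<nabla>R\<^sup>*\<close> shows that the energy \<open>a(u,u)/2 - F(u)\<close> does not increase along the iteration, so all \<open>u\<^sup>k\<close>
  are bounded.  The inf-sup condition then bounds the multipliers \<open>\<lambda>\<^sup>k\<close>; summing \<open>\<alpha>\<^sub>k \<lambda>\<^sup>k\<close> bounds \<open>\<psi>\<^sup>l\<close>
  in \<open>Q'\<close>, and the displayed inequality for \<open>k = l\<close> bounds it in \<open>L\<^sup>1\<close>.

  The measure need not be finite.  If it is infinite, the hypothesis that \<open>\<nabla>R\<^sup>*\<close> maps constants into \<open>L\<^sup>2\<close>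
  forces \<open>\<nabla>R\<^sub>0\<^sup>* = 0\<close> and \<open>\<nu>\<^sub>1 = 0\<close>, and the inequality is trivial.
\<close>

section \<open>Abstract stability estimate\<close>

text \<open>A root-free majorant of the larger root of \<open>\<nu> * x\<^sup>2 = A * x + D\<close>;
  any bound depending only on the data serves.\<close>

definition quadratic_root_bound :: "real \<Rightarrow> real \<Rightarrow> real \<Rightarrow> real" where
  "quadratic_root_bound \<nu> A D = 1 + (A + D) / \<nu>"

text \<open>For \<open>x > 1\<close> the constant \<open>D\<close> is at most \<open>D * x\<close>,
  so a factor \<open>x\<close> cancels.\<close>

lemma le_quadratic_root_bound:
  fixes x :: real
  assumes "\<nu> > 0" "A \<ge> 0" "D \<ge> 0" "\<nu> * x\<^sup>2 \<le> A * x + D"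
  shows "x \<le> quadratic_root_bound \<nu> A D"
proof (cases "x \<le> 1")
  case True
  moreover have "(A + D) / \<nu> \<ge> 0"
    using assms by simp
  ultimately show ?thesis
    unfolding quadratic_root_bound_def by linarith
next
  case False
  then have "D \<le> D * x"
    using assms(3) by (simp add: mult_le_cancel_left1)
  with assms(4) have "(\<nu> * x) * x \<le> (A + D) * x"
    by (simp add: power2_eq_square algebra_simps)
  with False have "\<nu> * x \<le> A + D"
    by simp
  then have "x \<le> (A + D) / \<nu>"
    using assms(1) by (simp add: field_simps)
  then show ?thesis
    unfolding quadratic_root_bound_def by linarith
qed

lemma blinfun_le: "blinfun_apply (f :: 'x::real_normed_vector \<Rightarrow>\<^sub>L real) x \<le> norm f * norm x"
  using norm_blinfun[of f x] by simp

text \<open>One run of the method at a fixed mesh size: \<open>\<Lambda> k\<close> stands for the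
  k-th latent variable as a functional, \<open>N k\<close> for its weighted L1 norm,
  \<open>p\<close> for the Fortin image of a preimage of \<open>\<phi>1\<close>. The inf-sup
  inequality is assumed just for \<open>\<Lambda> 0\<close> and the increments, because it holds for
  functionals from the discrete space and not on the whole dual.\<close>

locale proximal_sequence =
  fixes a :: "'v::real_normed_vector \<Rightarrow> 'v \<Rightarrow> real"
    and B :: "'v \<Rightarrow>\<^sub>L 'q::real_normed_vector"
    and F :: "'v \<Rightarrow>\<^sub>L real"
    and V :: "'v set"
    and \<alpha> :: "nat \<Rightarrow> real"
    and u :: "nat \<Rightarrow> 'v"
    and \<Lambda> :: "nat \<Rightarrow> 'q \<Rightarrow>\<^sub>L real"
    and N :: "nat \<Rightarrow> real"
    and p :: 'v
    and \<nu> M \<beta> c0 K P \<alpha>1 :: real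
  assumes a_bilinear: "bilinear a"
    and a_sym: "a v w = a w v"
    and a_coercive: "\<nu> * (norm v)\<^sup>2 \<le> a v v"
    and a_bounded: "a v w \<le> M * norm v * norm w"
    and \<nu>_pos: "\<nu> > 0" and M_pos: "M > 0" and \<beta>_pos: "\<beta> > 0" and K_nonneg: "K \<ge> 0"
    and V_subspace: "subspace V"
    and p_in: "p \<in> V" and p_bound: "norm p \<le> P"
    and \<alpha>_pos: "k \<ge> 1 \<Longrightarrow> \<alpha> k > 0"
    and \<alpha>_first: "\<alpha> 1 = \<alpha>1"
    and u_in: "k \<ge> 1 \<Longrightarrow> u k \<in> V"
    and step: "k \<ge> 1 \<Longrightarrow> v \<in> V \<Longrightarrow> \<alpha> k * a (u k) v + (\<Lambda> k - \<Lambda> (k - 1)) (B v) = \<alpha> k * F v"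
    and monotone_step: "k \<ge> 2 \<Longrightarrow> 0 \<le> (\<Lambda> k - \<Lambda> (k - 1)) (B (u k - u (k - 1)))"
    and N_nonneg: "k \<ge> 1 \<Longrightarrow> N k \<ge> 0"
    and N_le: "k \<ge> 1 \<Longrightarrow> N k - K \<le> \<Lambda> k (B (u k - p))"
    and initial: "norm (dual_adjoint B (\<Lambda> 0)) \<le> c0"
    and inf_sup_initial: "c \<ge> 0 \<Longrightarrow> (\<And>v. v \<in> V \<Longrightarrow> \<Lambda> 0 (B v) \<le> c * norm v) \<Longrightarrow> \<beta> * norm (\<Lambda> 0) \<le> c"
    and inf_sup_step: "k \<ge> 1 \<Longrightarrow> c \<ge> 0 \<Longrightarrow>
      (\<And>v. v \<in> V \<Longrightarrow> (\<Lambda> (k - 1) - \<Lambda> k) (B v) \<le> c * norm v) \<Longrightarrow> \<beta> * norm (\<Lambda> (k - 1) - \<Lambda> k) \<le> c"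
begin

lemmas a_diff_left = bilinear_lsub[OF a_bilinear]
  and a_diff_right = bilinear_rsub[OF a_bilinear]

lemma P_nonneg: "P \<ge> 0"
  using p_bound norm_ge_zero order_trans by blast

lemma c0_nonneg: "c0 \<ge> 0"
  using initial norm_ge_zero order_trans by blast

lemma \<alpha>1_pos: "\<alpha>1 > 0"
  using \<alpha>_pos[of 1] \<alpha>_first by simp

lemma initial_le: "\<bar>\<Lambda> 0 (B v)\<bar> \<le> c0 * norm v"
proof -
  have "\<bar>\<Lambda> 0 (B v)\<bar> \<le> norm (dual_adjoint B (\<Lambda> 0)) * norm v"
    using norm_blinfun[of "dual_adjoint B (\<Lambda> 0)" v] by (simp add: dual_adjoint_def)
  also have "\<dots> \<le> c0 * norm v"
    using initial by (intro mult_right_mono) auto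
  finally show ?thesis .
qed

section \<open>Bound on the first primal iterate\<close>

definition first_bound :: real where
  "first_bound = quadratic_root_bound (\<alpha>1 * \<nu>)
     (\<alpha>1 * M * P + c0 + \<alpha>1 * norm F) (K + (c0 + \<alpha>1 * norm F) * P)"

lemma norm_first_le: "norm (u 1) \<le> first_bound"
proof -
  have up: "u 1 - p \<in> V"
    using V_subspace u_in p_in by (simp add: subspace_diff)
  have n: "norm (u 1 - p) \<le> norm (u 1) + P"
    using norm_triangle_ineq4[of "u 1" p] p_bound by linarith
  have "\<alpha>1 * (\<nu> * (norm (u 1))\<^sup>2) \<le> \<alpha>1 * a (u 1) (u 1)"
    using \<alpha>1_pos a_coercive by (intro mult_left_mono) auto
  \<comment> \<open>The first step tested with \<open>u 1 - p\<close>. The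
    \<open>\<Lambda> 0\<close> term is controlled by \<open>c0\<close>, the
    \<open>\<Lambda> 1\<close> term by \<open>N_le\<close> after dropping
    \<open>N 1 \<ge> 0\<close>.\<close>
  also have "\<dots> = \<alpha>1 * a (u 1) p + \<Lambda> 0 (B (u 1 - p)) - \<Lambda> 1 (B (u 1 - p)) + \<alpha>1 * F (u 1 - p)"
    using step[of 1, OF _ up] \<alpha>_first by (simp add: a_diff_right minus_blinfun.rep_eq algebra_simps)
  also have "\<dots> \<le> \<alpha>1 * (M * norm (u 1) * P) + c0 * (norm (u 1) + P) + K + \<alpha>1 * (norm F * (norm (u 1) + P))"
  proof -
    have "a (u 1) p \<le> M * norm (u 1) * norm p"
      by (rule a_bounded)
    also have "\<dots> \<le> M * norm (u 1) * P"
      using M_pos p_bound by (intro mult_left_mono) auto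
    finally have "\<alpha>1 * a (u 1) p \<le> \<alpha>1 * (M * norm (u 1) * P)"
      using \<alpha>1_pos by (intro mult_left_mono) auto
    moreover have "\<Lambda> 0 (B (u 1 - p)) \<le> c0 * (norm (u 1) + P)"
      using initial_le[of "u 1 - p"] mult_left_mono[OF n c0_nonneg] by linarith
    moreover have "- \<Lambda> 1 (B (u 1 - p)) \<le> K"
      using N_le[of 1] N_nonneg[of 1] by simp
    moreover have "F (u 1 - p) \<le> norm F * (norm (u 1) + P)"
      using blinfun_le[of F "u 1 - p"] mult_left_mono[OF n, of "norm F"] by simp
    then have "\<alpha>1 * F (u 1 - p) \<le> \<alpha>1 * (norm F * (norm (u 1) + P))"
      using \<alpha>1_pos by (intro mult_left_mono) auto
    ultimately show ?thesis
      by linarith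
  qed
  finally have "\<alpha>1 * \<nu> * (norm (u 1))\<^sup>2 \<le>
      (\<alpha>1 * M * P + c0 + \<alpha>1 * norm F) * norm (u 1) + (K + (c0 + \<alpha>1 * norm F) * P)"
    by (simp add: algebra_simps)
  then show ?thesis
    unfolding first_bound_def using \<alpha>1_pos \<nu>_pos M_pos P_nonneg c0_nonneg K_nonneg
    by (intro le_quadratic_root_bound) auto
qed

section \<open>Energy decrease and bounds on all primal iterates\<close>

definition energy :: "'v \<Rightarrow> real" where
  "energy v = a v v / 2 - F v"

text \<open>With \<open>w = u k - u (k - 1)\<close>, symmetry of \<open>a\<close> makes the energy
  difference equal to \<open>a (u k) w - F w - a w w / 2\<close>. The restriction
  \<open>k \<ge> 2\<close> is needed since \<open>u 0\<close> satisfies no equation.\<close>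

lemma energy_step:
  assumes "k \<ge> 2"
  shows "energy (u k) \<le> energy (u (k - 1))"
proof -
  let ?w = "u k - u (k - 1)"
  have "?w \<in> V"
    using V_subspace u_in[of k] u_in[of "k - 1"] assms by (simp add: subspace_diff)
  with step[of k ?w] monotone_step[OF assms] assms have "\<alpha> k * a (u k) ?w \<le> \<alpha> k * F ?w"
    by simp
  then have "a (u k) ?w \<le> F ?w"
    using \<alpha>_pos[of k] assms by simp
  moreover have "0 \<le> a ?w ?w"
    by (rule order_trans[OF _ a_coercive]) (use \<nu>_pos in simp)
  ultimately show ?thesis
    using a_sym[of "u k" "u (k - 1)"]
    by (simp add: energy_def a_diff_left a_diff_right blinfun.diff_right)
qed

lemma energy_le_first:
  assumes "l \<ge> 1"
  shows "energy (u l) \<le> energy (u 1)"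
  using assms
proof (induction l rule: dec_induct)
  case (step n)
  then show ?case
    using energy_step[of "Suc n"] by simp
qed simp

definition primal_bound :: real where
  "primal_bound = quadratic_root_bound (\<nu> / 2) (norm F) (M * first_bound\<^sup>2 / 2 + norm F * first_bound)"

text \<open>Coercivity bounds the energy of \<open>u l\<close> from below by a quadratic in its
  norm, while the energy of \<open>u 1\<close> is bounded through
  \<open>first_bound\<close>.\<close>

lemma norm_primal_le:
  assumes "l \<ge> 1"
  shows "norm (u l) \<le> primal_bound"
proof -
  have first_nonneg: "0 \<le> first_bound"
    using norm_first_le norm_ge_zero order_trans by blast
  have "a (u 1) (u 1) \<le> M * (norm (u 1))\<^sup>2"
    using a_bounded[of "u 1" "u 1"] by (simp add: power2_eq_square mult.assoc)
  also have "\<dots> \<le> M * first_bound\<^sup>2"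
    using norm_first_le M_pos by (intro mult_left_mono power_mono) auto
  finally have "a (u 1) (u 1) \<le> M * first_bound\<^sup>2" .
  moreover have "- F (u 1) \<le> norm F * first_bound"
    using norm_blinfun[of F "u 1"] mult_left_mono[OF norm_first_le, of "norm F"] by simp
  moreover note energy_le_first[OF assms] a_coercive[of "u l"] blinfun_le[of F "u l"]
  ultimately have "\<nu> / 2 * (norm (u l))\<^sup>2 \<le> norm F * norm (u l) + (M * first_bound\<^sup>2 / 2 + norm F * first_bound)"
    by (simp add: energy_def)
  then show ?thesis
    unfolding primal_bound_def using \<nu>_pos M_pos first_nonneg
    by (intro le_quadratic_root_bound) auto
qed

section \<open>Bounds on multipliers and latent variables\<close>

definition multiplier_bound :: real where
  "multiplier_bound = (M * primal_bound + norm F) / \<beta>"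

text \<open>By the iteration the increment acts on \<open>V\<close> as \<open>\<alpha> k\<close>
  times the residual \<open>a (u k) v - F v\<close>; the inf-sup condition turns this into a dual
  norm bound, and the factor \<open>\<alpha> k\<close> later cancels in the multiplier.\<close>

lemma norm_increment_le:
  assumes "k \<ge> 1"
  shows "norm (\<Lambda> (k - 1) - \<Lambda> k) \<le> \<alpha> k * multiplier_bound"
proof -
  have primal_nonneg: "0 \<le> primal_bound"
    using norm_primal_le[OF assms] norm_ge_zero order_trans by blast
  have "\<beta> * norm (\<Lambda> (k - 1) - \<Lambda> k) \<le> \<alpha> k * (M * primal_bound + norm F)"
  proof (rule inf_sup_step[OF assms])
    show "0 \<le> \<alpha> k * (M * primal_bound + norm F)"
      using \<alpha>_pos[OF assms] M_pos primal_nonneg by simp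
  next
    fix v assume v: "v \<in> V"
    have "a (u k) v \<le> M * norm (u k) * norm v"
      by (rule a_bounded)
    also have "\<dots> \<le> M * primal_bound * norm v"
      using norm_primal_le[OF assms] M_pos by (intro mult_left_mono mult_right_mono) auto
    finally have "a (u k) v - F v \<le> (M * primal_bound + norm F) * norm v"
      using norm_blinfun[of F v] by (simp add: algebra_simps)
    then have "\<alpha> k * (a (u k) v - F v) \<le> \<alpha> k * ((M * primal_bound + norm F) * norm v)"
      using \<alpha>_pos[OF assms] by (intro mult_left_mono) auto
    moreover have "(\<Lambda> (k - 1) - \<Lambda> k) (B v) = \<alpha> k * (a (u k) v - F v)"
      using step[OF assms v] by (simp add: minus_blinfun.rep_eq algebra_simps)
    ultimately show "(\<Lambda> (k - 1) - \<Lambda> k) (B v) \<le> \<alpha> k * (M * primal_bound + norm F) * norm v"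
      by (simp add: mult.assoc)
  qed
  then show ?thesis
    unfolding multiplier_bound_def using \<beta>_pos by (simp add: field_simps)
qed

text \<open>The increments telescope down to \<open>\<Lambda> 0\<close>, whose norm the inf-sup
  condition recovers from that of \<open>dual_adjoint B (\<Lambda> 0)\<close>.\<close>

lemma norm_dual_le: "norm (\<Lambda> l) \<le> c0 / \<beta> + multiplier_bound * (\<Sum>k=1..l. \<alpha> k)"
proof (induction l)
  case 0
  have "\<beta> * norm (\<Lambda> 0) \<le> c0"
    using c0_nonneg initial_le by (intro inf_sup_initial) (auto intro: order_trans[OF abs_ge_self])
  then show ?case
    using \<beta>_pos by (simp add: field_simps)
next
  case (Suc l)
  have "norm (\<Lambda> (Suc l)) \<le> norm (\<Lambda> l) + norm (\<Lambda> l - \<Lambda> (Suc l))"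
    using norm_triangle_sub[of "\<Lambda> (Suc l)" "\<Lambda> l"] by (simp add: norm_minus_commute)
  with Suc norm_increment_le[of "Suc l"] show ?case
    by (simp add: algebra_simps)
qed

text \<open>Dividing by \<open>\<alpha>1\<close> turns the constant \<open>c0 / \<beta>\<close> into
  a multiple of the sum of the step sizes, which is at least \<open>\<alpha>1\<close>.\<close>

definition dual_bound :: real where
  "dual_bound = c0 / (\<beta> * \<alpha>1) + multiplier_bound"

text \<open>Of all step sizes only \<open>\<alpha>1\<close> enters, and neither \<open>V\<close>,
  \<open>u\<close>, \<open>\<Lambda>\<close>, \<open>N\<close> nor \<open>p\<close> does; this makes
  the estimate uniform over meshes and iterations. The bracketed last summand is the share of
  \<open>N l\<close>.\<close>

definition stability_bound :: real where
  "stability_bound = \<nu> * primal_bound + multiplier_bound + dual_bound +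
     (K / \<alpha>1 + dual_bound * norm B * (primal_bound + P))"

theorem stability:
  assumes "l \<ge> 1"
  shows "\<nu> * norm (u l) + norm ((1 / \<alpha> l) *\<^sub>R (\<Lambda> (l - 1) - \<Lambda> l)) + (norm (\<Lambda> l) + N l) / (\<Sum>k=1..l. \<alpha> k)
    \<le> stability_bound"
proof -
  define s where "s = (\<Sum>k=1..l. \<alpha> k)"
  have s_ge: "\<alpha>1 \<le> s"
    unfolding s_def \<alpha>_first[symmetric] using assms by (intro member_le_sum) (auto intro!: less_imp_le \<alpha>_pos)
  have s: "s > 0"
    using \<alpha>1_pos s_ge by linarith
  have "c0 / \<beta> = c0 / (\<beta> * \<alpha>1) * \<alpha>1"
    using \<alpha>1_pos by simp
  also have "\<dots> \<le> c0 / (\<beta> * \<alpha>1) * s"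
    using s_ge c0_nonneg \<alpha>1_pos \<beta>_pos by (intro mult_left_mono) auto
  finally have dual: "norm (\<Lambda> l) \<le> dual_bound * s"
    using norm_dual_le[of l] by (simp add: s_def dual_bound_def algebra_simps)
  have primal: "\<nu> * norm (u l) \<le> \<nu> * primal_bound"
    using norm_primal_le[OF assms] \<nu>_pos by simp
  have mult: "norm ((1 / \<alpha> l) *\<^sub>R (\<Lambda> (l - 1) - \<Lambda> l)) \<le> multiplier_bound"
    using norm_increment_le[OF assms] \<alpha>_pos[OF assms]
    by (simp add: pos_divide_le_eq mult.commute del: scaleR_diff_right)
  \<comment> \<open>This pairing dominates \<open>N l - K\<close>, so the dual norm bound on
    \<open>\<Lambda> l\<close> carries over to \<open>N l\<close>.\<close>
  have "\<Lambda> l (B (u l - p)) \<le> norm (\<Lambda> l) * norm (B (u l - p))"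
    by (rule blinfun_le)
  also have "\<dots> \<le> (dual_bound * s) * (norm B * (primal_bound + P))"
  proof (intro mult_mono dual)
    have "norm (B (u l - p)) \<le> norm B * norm (u l - p)"
      by (rule norm_blinfun)
    also have "norm (u l - p) \<le> primal_bound + P"
      using norm_triangle_ineq4[of "u l" p] norm_primal_le[OF assms] p_bound by linarith
    finally show "norm (B (u l - p)) \<le> norm B * (primal_bound + P)"
      by (simp add: mult_left_mono)
    show "0 \<le> dual_bound * s"
      using dual norm_ge_zero order_trans by blast
  qed auto
  finally have "N l \<le> K + dual_bound * norm B * (primal_bound + P) * s"
    using N_le[OF assms] by (simp add: algebra_simps)
  moreover have "K \<le> K / \<alpha>1 * s"
    using s_ge \<alpha>1_pos K_nonneg mult_left_mono[of "\<alpha>1" s K] by (simp add: field_simps)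
  ultimately have "norm (\<Lambda> l) + N l \<le> (dual_bound + (K / \<alpha>1 + dual_bound * norm B * (primal_bound + P))) * s"
    using dual by (simp add: algebra_simps)
  then have "(norm (\<Lambda> l) + N l) / s \<le> dual_bound + (K / \<alpha>1 + dual_bound * norm B * (primal_bound + P))"
    using s by (simp add: pos_divide_le_eq)
  with primal mult show ?thesis
    unfolding stability_bound_def s_def[symmetric] by linarith
qed

end

section \<open>Bounded functions as functionals\<close>

lemma Linf_space_iff:
  "f \<in> Linf_space \<mu> \<longleftrightarrow> f \<in> borel_measurable \<mu> \<and> (\<exists>c. AE x in \<mu>. norm (f x) \<le> c)"
proof
  assume f: "f \<in> Linf_space \<mu>"
  then have m: "f \<in> borel_measurable \<mu>" and e: "esssup \<mu> (\<lambda>x. ereal (norm (f x))) < \<infinity>"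
    by (auto simp: Linf_space_def)
  \<comment> \<open>The essential supremum is minus infinity on a null space, so only a real upper
    bound is extracted.\<close>
  obtain c where c: "esssup \<mu> (\<lambda>x. ereal (norm (f x))) \<le> ereal c"
    using e by (metis ereal_infty_less(1) less_ereal.simps(2) linear order_le_less real_of_ereal.cases ereal_less_eq(2))
  have "AE x in \<mu>. ereal (norm (f x)) \<le> esssup \<mu> (\<lambda>x. ereal (norm (f x)))"
    by (rule esssup_AE)
  then have "AE x in \<mu>. norm (f x) \<le> c"
    by eventually_elim (use c order_trans in fastforce)
  with m show "f \<in> borel_measurable \<mu> \<and> (\<exists>c. AE x in \<mu>. norm (f x) \<le> c)"
    by blast
next
  assume "f \<in> borel_measurable \<mu> \<and> (\<exists>c. AE x in \<mu>. norm (f x) \<le> c)"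
  then obtain c where m: "f \<in> borel_measurable \<mu>" and c: "AE x in \<mu>. norm (f x) \<le> c"
    by blast
  have "esssup \<mu> (\<lambda>x. ereal (norm (f x))) \<le> ereal c"
    using m c by (intro esssup_I) auto
  then show "f \<in> Linf_space \<mu>"
    using m by (auto simp: Linf_space_def intro: le_less_trans)
qed

lemma Linf_space_const: "(\<lambda>_. c) \<in> Linf_space \<mu>"
  by (auto simp: Linf_space_iff)

lemma Linf_space_diff:
  assumes "f \<in> Linf_space \<mu>" "g \<in> Linf_space \<mu>"
  shows "(\<lambda>x. f x - g x) \<in> Linf_space \<mu>"
proof -
  obtain c d where "AE x in \<mu>. norm (f x) \<le> c" "AE x in \<mu>. norm (g x) \<le> d"
    using assms by (auto simp: Linf_space_iff)
  then have "AE x in \<mu>. norm (f x - g x) \<le> c + d"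
    by eventually_elim (use norm_triangle_ineq4 order_trans add_mono in metis)
  with assms show ?thesis
    by (auto simp: Linf_space_iff)
qed

lemma Linf_space_integrable:
  fixes f :: "'a \<Rightarrow> 'b::euclidean_space"
  assumes "finite_measure \<mu>" "f \<in> Linf_space \<mu>"
  shows "integrable \<mu> f"
  using assms finite_measure.integrable_const_bound[of \<mu> f] by (auto simp: Linf_space_iff)

text \<open>Pointwise the product is at most the sum of squares, and the square of the bound on
  \<open>g\<close> is integrable because the measure is finite.\<close>

lemma L2_Linf_integrable_inner:
  fixes f g :: "'a \<Rightarrow> 'b::euclidean_space"
  assumes "finite_measure \<mu>" "f \<in> L2_space \<mu>" "g \<in> Linf_space \<mu>"
  shows "integrable \<mu> (\<lambda>x. f x \<bullet> g x)"
proof -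
  obtain c where c: "AE x in \<mu>. norm (g x) \<le> c"
    using assms by (auto simp: Linf_space_iff)
  have m: "f \<in> borel_measurable \<mu>" "g \<in> borel_measurable \<mu>" "integrable \<mu> (\<lambda>x. (norm (f x))\<^sup>2)"
    using assms by (auto simp: Linf_space_def L2_space_def)
  have "integrable \<mu> (\<lambda>x. (norm (f x))\<^sup>2 + c\<^sup>2)"
    using m assms(1) by (intro Bochner_Integration.integrable_add finite_measure.integrable_const)
  moreover have "(\<lambda>x. f x \<bullet> g x) \<in> borel_measurable \<mu>"
    using m by measurable
  moreover have "AE x in \<mu>. norm (f x \<bullet> g x) \<le> norm ((norm (f x))\<^sup>2 + c\<^sup>2)"
    using c
  proof eventually_elim
    case (elim x)
    have "norm (f x \<bullet> g x) \<le> norm (f x) * norm (g x)"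
      using Cauchy_Schwarz_ineq2 by simp
    also have "\<dots> \<le> (norm (f x))\<^sup>2 + (norm (g x))\<^sup>2"
      using sum_squares_bound[of "norm (f x)" "norm (g x)"] mult_nonneg_nonneg[of "norm (f x)" "norm (g x)"]
      by (simp del: mult_nonneg_nonneg)
    also have "(norm (g x))\<^sup>2 \<le> c\<^sup>2"
      using elim by (simp add: power_mono)
    finally show ?case
      by simp
  qed
  ultimately show ?thesis
    by (rule Bochner_Integration.integrable_bound)
qed

text \<open>\<open>Blinfun\<close> is meaningful only on bounded linear maps, hence the premise here
  and in the lemmas that rest on this one.\<close>

lemma to_dual_apply: "is_functional_on \<mu> \<iota> w \<Longrightarrow> blinfun_apply (to_dual \<mu> \<iota> w) q = L2_inner \<mu> w (\<iota> q)"
  by (simp add: to_dual_def is_functional_on_def bounded_linear_Blinfun_apply)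

lemma bform_eq_to_dual:
  "is_functional_on \<mu> \<iota> w \<Longrightarrow> bform \<mu> \<iota> B v w = blinfun_apply (to_dual \<mu> \<iota> w) (blinfun_apply B v)"
  by (simp add: to_dual_apply bform_def L2_inner_def inner_commute)

lemma to_dual_diff:
  assumes "is_functional_on \<mu> \<iota> w" "is_functional_on \<mu> \<iota> z" "is_functional_on \<mu> \<iota> (\<lambda>x. w x - z x)"
  shows "to_dual \<mu> \<iota> (\<lambda>x. w x - z x) = to_dual \<mu> \<iota> w - to_dual \<mu> \<iota> z"
  using assms
  by (intro blinfun_eqI)
    (simp add: minus_blinfun.rep_eq to_dual_apply L2_inner_def inner_diff_left is_functional_on_def)

lemma to_dual_scaleR:
  fixes \<iota> :: "'q::real_normed_vector \<Rightarrow> 'a \<Rightarrow> 'b::euclidean_space"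
  assumes "is_functional_on \<mu> \<iota> w"
  shows "to_dual \<mu> \<iota> (\<lambda>x. c *\<^sub>R w x) = c *\<^sub>R to_dual \<mu> \<iota> w"
proof -
  have "is_functional_on \<mu> \<iota> (\<lambda>x. c *\<^sub>R w x)"
    using assms by (simp add: is_functional_on_def L2_inner_def bounded_linear_const_mult)
  then show ?thesis
    using assms by (intro blinfun_eqI) (simp add: scaleR_blinfun.rep_eq to_dual_apply L2_inner_def)
qed

section \<open>The discrete latent space and its inf-sup condition\<close>

lemma finite_dim_subspace_Linf_diff:
  assumes "finite_dim_subspace_Linf \<mu> S" "w \<in> S" "z \<in> S"
  shows "(\<lambda>x. w x - z x) \<in> S"
proof -
  obtain N :: nat and e where S: "S = {w \<in> Linf_space \<mu>. \<exists>c. AE x in \<mu>. w x = (\<Sum>i<N. c i *\<^sub>R e i x)}"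
    using assms(1) by (auto simp: finite_dim_subspace_Linf_def)
  from assms(2,3) S obtain c c' where
    "AE x in \<mu>. w x = (\<Sum>i<N. c i *\<^sub>R e i x)" "AE x in \<mu>. z x = (\<Sum>i<N. c' i *\<^sub>R e i x)"
    by auto
  then have "AE x in \<mu>. w x - z x = (\<Sum>i<N. (c i - c' i) *\<^sub>R e i x)"
    by eventually_elim (simp add: scaleR_left_diff_distrib sum_subtractf)
  with assms(2,3) show ?thesis
    unfolding S by (auto intro!: Linf_space_diff exI[of _ "\<lambda>i. c i - c' i"])
qed

text \<open>The supremum for \<open>w\<close> strictly exceeds \<open>\<beta>\<close>, so a single
  nonzero \<open>v\<close> already has quotient above \<open>\<beta>\<close>; its norm then
  cancels.\<close>

lemma inf_sup_bound:
  assumes inf_sup: "inf_sup_constant \<mu> \<iota> B V W > ereal \<beta>"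
    and w: "w \<in> W" "is_functional_on \<mu> \<iota> w"
    and c: "c \<ge> 0" "\<And>v. v \<in> V \<Longrightarrow> blinfun_apply (to_dual \<mu> \<iota> w) (blinfun_apply B v) \<le> c * norm v"
  shows "\<beta> * norm (to_dual \<mu> \<iota> w) \<le> c"
proof (cases "norm (to_dual \<mu> \<iota> w) = 0")
  case True
  then show ?thesis
    using c by simp
next
  case False
  \<comment> \<open>Ensures that \<open>w\<close> takes part in the infimum, which runs over
    functions that do not vanish almost everywhere.\<close>
  have "\<not> (AE x in \<mu>. w x = 0)"
  proof
    assume AE: "AE x in \<mu>. w x = 0"
    have "to_dual \<mu> \<iota> w = 0"
    proof (rule blinfun_eqI)
      fix q
      have "(LINT x|\<mu>. w x \<bullet> \<iota> q x) = 0"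
        by (rule integral_eq_zero_AE) (use AE in eventually_elim, simp)
      then show "blinfun_apply (to_dual \<mu> \<iota> w) q = blinfun_apply 0 q"
        using w(2) by (simp add: to_dual_apply L2_inner_def)
    qed
    with False show False by simp
  qed
  with inf_sup w(1) have
    "ereal \<beta> < (SUP v \<in> V - {0}. ereal (bform \<mu> \<iota> B v w / (norm v * norm (to_dual \<mu> \<iota> w))))"
    unfolding inf_sup_constant_def by (elim less_le_trans) (auto intro: INF_lower)
  then obtain v where v: "v \<in> V" "v \<noteq> 0"
    and "\<beta> < bform \<mu> \<iota> B v w / (norm v * norm (to_dual \<mu> \<iota> w))"
    by (auto simp: less_SUP_iff)
  then have "\<beta> * (norm v * norm (to_dual \<mu> \<iota> w)) < bform \<mu> \<iota> B v w"
    using False by (simp add: pos_less_divide_eq)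
  also have "\<dots> \<le> c * norm v"
    using c v w by (simp add: bform_eq_to_dual)
  finally have "(\<beta> * norm (to_dual \<mu> \<iota> w)) * norm v < c * norm v"
    by (simp add: mult_ac)
  then show ?thesis
    using v by simp
qed

section \<open>Gradients of convex functions\<close>

text \<open>As \<open>gradient\<close> is a definite description, the derivative must be represented
  by a vector \<open>D\<close>, built from its values on the basis, and \<open>D\<close> must be
  unique.\<close>

lemma GDERIV_gradient:
  fixes f :: "'b::euclidean_space \<Rightarrow> real"
  assumes "f differentiable (at x)"
  shows "GDERIV f x :> gradient f x"
proof -
  obtain f' where f': "(f has_derivative f') (at x)"
    using assms by (auto simp: differentiable_def)
  then interpret bounded_linear f'
    by (rule has_derivative_bounded_linear)
  define D where "D = (\<Sum>b\<in>Basis. f' b *\<^sub>R b)"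
  have "f' h = h \<bullet> D" for h
  proof -
    have "f' h = f' (\<Sum>b\<in>Basis. (h \<bullet> b) *\<^sub>R b)"
      by (simp add: euclidean_representation)
    also have "\<dots> = h \<bullet> D"
      by (simp add: sum scaleR D_def inner_sum_right mult.commute)
    finally show ?thesis .
  qed
  then have D: "GDERIV f x :> D"
    using f' unfolding gderiv_def by (metis (no_types, lifting) ext)
  have "D' = D" if "GDERIV f x :> D'" for D'
  proof -
    have "(\<lambda>h. h \<bullet> D') = (\<lambda>h. h \<bullet> D)"
      using that D unfolding gderiv_def by (rule has_derivative_unique)
    then have "(D' - D) \<bullet> (D' - D) = 0"
      by (metis inner_diff_right right_minus_eq)
    then show ?thesis by simp
  qed
  with D show ?thesis
    unfolding gradient_def by (metis theI)
qed

text \<open>Restricted to the line through \<open>x\<close> and \<open>y\<close>, this is the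
  tangent inequality for a convex function of one variable.\<close>

lemma convex_gradient_ineq:
  fixes f :: "'b::euclidean_space \<Rightarrow> real"
  assumes "convex_on UNIV f" "f differentiable (at x)"
  shows "gradient f x \<bullet> (y - x) \<le> f y - f x"
proof -
  define g where "g t = f (x + t *\<^sub>R (y - x))" for t
  have "convex_on UNIV g"
  proof (rule convex_onI)
    fix t r s :: real assume "0 < t" "t < 1"
    have "x + ((1 - t) *\<^sub>R r + t *\<^sub>R s) *\<^sub>R (y - x) =
        (1 - t) *\<^sub>R (x + r *\<^sub>R (y - x)) + t *\<^sub>R (x + s *\<^sub>R (y - x))"
      by (simp add: algebra_simps)
    then show "g ((1 - t) *\<^sub>R r + t *\<^sub>R s) \<le> (1 - t) * g r + t * g s"
      unfolding g_def using convex_onD[OF assms(1)] \<open>0 < t\<close> \<open>t < 1\<close> by simp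
  qed simp
  moreover have "(g has_real_derivative gradient f x \<bullet> (y - x)) (at 0)"
  proof -
    have "(f has_derivative (\<lambda>h. h \<bullet> gradient f x)) (at (x + 0 *\<^sub>R (y - x)))"
      using GDERIV_gradient[OF assms(2)] by (simp add: gderiv_def)
    moreover have "((\<lambda>t. x + t *\<^sub>R (y - x)) has_derivative (\<lambda>t. t *\<^sub>R (y - x))) (at 0)"
      by (auto intro!: derivative_eq_intros)
    ultimately have "(g has_derivative (\<lambda>t. (t *\<^sub>R (y - x)) \<bullet> gradient f x)) (at 0)"
      unfolding g_def by (rule has_derivative_compose[rotated])
    then show ?thesis
      by (simp add: has_field_derivative_def inner_commute mult_commute_abs)
  qed
  ultimately have "gradient f x \<bullet> (y - x) * (1 - 0) \<le> g 1 - g 0"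
    by (intro convex_on_imp_above_tangent[of UNIV]) auto
  then show ?thesis
    by (simp add: g_def)
qed

lemma convex_gradient_mono:
  fixes f :: "'b::euclidean_space \<Rightarrow> real"
  assumes "convex_on UNIV f" "\<And>z. f differentiable (at z)"
  shows "0 \<le> (gradient f x - gradient f y) \<bullet> (x - y)"
  using convex_gradient_ineq[OF assms(1,2), of x y] convex_gradient_ineq[OF assms(1,2), of y x]
  by (simp add: inner_diff_left inner_diff_right)

text \<open>Here \<open>G\<close> is the gradient of the conjugate acting on functions and
  \<open>f\<close> its pointwise profile. The aim is monotonicity and a coercivity estimate for
  \<open>G\<close>, without assuming \<open>\<mu>\<close> finite.\<close>

locale scaled_gradient =
  fixes \<mu> :: "'a measure"
    and G :: "('a \<Rightarrow> 'b::euclidean_space) \<Rightarrow> 'a \<Rightarrow> 'b"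
    and f :: "'b \<Rightarrow> real"
    and \<phi>0 :: "'a \<Rightarrow> real" and \<phi>1 :: "'a \<Rightarrow> 'b"
    and \<phi>0_low \<nu>1 c1 :: real
  assumes G_L2: "\<psi> \<in> Linf_space \<mu> \<Longrightarrow> G \<psi> \<in> L2_space \<mu>"
    and G_form: "\<psi> \<in> Linf_space \<mu> \<Longrightarrow> AE x in \<mu>. G \<psi> x = \<phi>0 x *\<^sub>R gradient f (\<psi> x) + \<phi>1 x"
    and \<phi>0_Linf: "\<phi>0 \<in> Linf_space \<mu>"
    and \<phi>0_ge: "AE x in \<mu>. \<phi>0_low \<le> \<phi>0 x" and \<phi>0_low_pos: "\<phi>0_low > 0"
    and \<phi>1_L2: "\<phi>1 \<in> L2_space \<mu>"
    and \<phi>1_integrable: "w \<in> Linf_space \<mu> \<Longrightarrow> integrable \<mu> (\<lambda>x. w x \<bullet> \<phi>1 x)"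
    and f_convex: "convex_on UNIV f" and f_diff: "f differentiable (at z)"
    and \<nu>1_nonneg: "\<nu>1 \<ge> 0"
    and f_ge: "\<psi> \<in> Linf_space \<mu> \<Longrightarrow> AE x in \<mu>. f (\<psi> x) - \<nu>1 * norm (\<psi> x) \<ge> c1"
begin

text \<open>On the constant function \<open>z\<close>, both \<open>G\<close> and
  \<open>\<phi>1\<close> are square integrable, and their difference is bounded below by a positive
  constant if the gradient is nonzero. That constant would be integrable.\<close>

lemma gradient_zero_if_infinite:
  assumes "\<not> finite_measure \<mu>"
  shows "gradient f z = 0"
proof (rule ccontr)
  assume nz: "gradient f z \<noteq> 0"
  define c where "c = (\<phi>0_low * norm (gradient f z))\<^sup>2"
  have c: "c > 0"
    using nz \<phi>0_low_pos by (simp add: c_def)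
  have L2: "G (\<lambda>_. z) \<in> L2_space \<mu>"
    by (intro G_L2 Linf_space_const)
  \<comment> \<open>Dominates \<open>(norm (G (\<lambda>_. z) x - \<phi>1 x))\<^sup>2\<close>, which
    is at least \<open>c\<close> almost everywhere.\<close>
  have int: "integrable \<mu> (\<lambda>x. 2 * (norm (G (\<lambda>_. z) x))\<^sup>2 + 2 * (norm (\<phi>1 x))\<^sup>2)"
    using L2 \<phi>1_L2 by (simp add: L2_space_def)
  have "integrable \<mu> (\<lambda>x. c)"
  proof (rule Bochner_Integration.integrable_bound[OF int])
    show "AE x in \<mu>. norm c \<le> norm (2 * (norm (G (\<lambda>_. z) x))\<^sup>2 + 2 * (norm (\<phi>1 x))\<^sup>2)"
      using G_form[OF Linf_space_const[of z]] \<phi>0_ge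
    proof eventually_elim
      case (elim x)
      let ?g = "G (\<lambda>_. z) x"
      have "\<phi>0_low * norm (gradient f z) \<le> \<phi>0 x * norm (gradient f z)"
        using elim by (simp add: mult_right_mono)
      also have "\<dots> = norm (?g - \<phi>1 x)"
        using elim \<phi>0_low_pos by simp
      also have "\<dots> \<le> norm ?g + norm (\<phi>1 x)"
        by (rule norm_triangle_ineq4)
      finally have "c \<le> (norm ?g + norm (\<phi>1 x))\<^sup>2"
        unfolding c_def using \<phi>0_low_pos by (intro power_mono) auto
      also have "\<dots> \<le> 2 * (norm ?g)\<^sup>2 + 2 * (norm (\<phi>1 x))\<^sup>2"
        using sum_squares_bound[of "norm ?g" "norm (\<phi>1 x)"] by (simp add: power2_sum)
      finally show ?case
        using c by simp
    qed
  qed simp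
  then have "finite_measure \<mu>"
    using c
    by (intro finite_measureI) (auto simp: integrable_iff_bounded ennreal_mult_less_top)
  with assms show False ..
qed

lemma growth_zero_if_infinite:
  assumes "\<not> finite_measure \<mu>"
  shows "\<nu>1 = 0"
proof (rule ccontr)
  assume "\<nu>1 \<noteq> 0"
  then have \<nu>1: "\<nu>1 > 0"
    using \<nu>1_nonneg by simp
  have const: "f z = f 0" for z
    using convex_gradient_ineq[OF f_convex f_diff, of 0 z] convex_gradient_ineq[OF f_convex f_diff, of z 0]
      gradient_zero_if_infinite[OF assms] by simp
  \<comment> \<open>With zero gradient \<open>f\<close> is constant, and this norm pushes
    \<open>f z - \<nu>1 * norm z\<close> below \<open>c1\<close>.\<close>
  obtain z :: 'b where z: "norm z = (\<bar>f 0\<bar> + \<bar>c1\<bar> + 1) / \<nu>1"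
    using vector_choose_size[of "(\<bar>f 0\<bar> + \<bar>c1\<bar> + 1) / \<nu>1"] \<nu>1 by auto
  have "AE x in \<mu>. f z - \<nu>1 * norm z \<ge> c1"
    using f_ge[OF Linf_space_const[of z]] .
  moreover have "\<not> f z - \<nu>1 * norm z \<ge> c1"
    using \<nu>1 by (simp add: const[of z] z)
  \<comment> \<open>The contradiction holds only almost everywhere; it makes \<open>\<mu>\<close>
    null, hence finite.\<close>
  ultimately have "AE x in \<mu>. False"
    by simp
  then have "emeasure \<mu> (space \<mu>) = 0"
    by (simp add: AE_iff_measurable[OF sets.top])
  then have "finite_measure \<mu>"
    by (intro finite_measureI) simp
  with assms show False ..
qed

text \<open>On an infinite measure space the gradient vanishes, so \<open>G \<psi>\<close> is
  \<open>\<phi>1\<close> almost everywhere, whose pairings with bounded functions are integrable by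
  assumption.\<close>

lemma integrable_G_inner:
  assumes "\<psi> \<in> Linf_space \<mu>" "w \<in> Linf_space \<mu>"
  shows "integrable \<mu> (\<lambda>x. G \<psi> x \<bullet> w x)"
proof (cases "finite_measure \<mu>")
  case True
  then show ?thesis
    using assms by (intro L2_Linf_integrable_inner G_L2)
next
  case False
  have "G \<psi> \<in> borel_measurable \<mu>" "w \<in> borel_measurable \<mu>"
    using assms G_L2[of \<psi>] by (auto simp: L2_space_def Linf_space_def)
  moreover have "AE x in \<mu>. w x \<bullet> \<phi>1 x = G \<psi> x \<bullet> w x"
    using G_form[OF assms(1)]
    by eventually_elim (simp add: gradient_zero_if_infinite[OF False] inner_commute)
  ultimately show ?thesis
    by (intro integrable_cong_AE_imp[OF \<phi>1_integrable[OF assms(2)]]) auto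
qed

text \<open>The shift \<open>\<phi>1\<close> cancels, leaving \<open>\<phi>0\<close> times the
  monotone gradient of a convex function.\<close>

lemma G_monotone:
  assumes "\<psi> \<in> Linf_space \<mu>" "\<eta> \<in> Linf_space \<mu>"
  shows "0 \<le> L2_inner \<mu> (G \<psi>) (\<lambda>x. \<psi> x - \<eta> x) - L2_inner \<mu> (G \<eta>) (\<lambda>x. \<psi> x - \<eta> x)"
proof -
  have "AE x in \<mu>. 0 \<le> G \<psi> x \<bullet> (\<psi> x - \<eta> x) - G \<eta> x \<bullet> (\<psi> x - \<eta> x)"
    using G_form[OF assms(1)] G_form[OF assms(2)] \<phi>0_ge
  proof eventually_elim
    case (elim x)
    have "G \<psi> x \<bullet> (\<psi> x - \<eta> x) - G \<eta> x \<bullet> (\<psi> x - \<eta> x) =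
        \<phi>0 x * ((gradient f (\<psi> x) - gradient f (\<eta> x)) \<bullet> (\<psi> x - \<eta> x))"
      using elim by (simp add: inner_diff_left inner_add_left algebra_simps)
    also have "\<dots> \<ge> 0"
      using elim \<phi>0_low_pos convex_gradient_mono[OF f_convex f_diff, of "\<psi> x" "\<eta> x"] by simp
    finally show ?case .
  qed
  then have "0 \<le> (LINT x|\<mu>. G \<psi> x \<bullet> (\<psi> x - \<eta> x) - G \<eta> x \<bullet> (\<psi> x - \<eta> x))"
    by (rule integral_nonneg_AE)
  then show ?thesis
    using integrable_G_inner[OF assms(1) Linf_space_diff[OF assms]]
      integrable_G_inner[OF assms(2) Linf_space_diff[OF assms]]
    by (simp add: L2_inner_def)
qed

text \<open>The absolute values make it nonnegative in every case, which is all that the infinite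
  case requires.\<close>

definition coercivity_defect :: real where
  "coercivity_defect = \<bar>f 0 - c1\<bar> * \<bar>LINT x|\<mu>. \<phi>0 x\<bar>"

text \<open>The tangent inequality at \<open>\<psi> x\<close>, evaluated at 0, combines with the
  growth bound to give \<open>gradient f (\<psi> x) \<bullet> \<psi> x \<ge> \<nu>1 * norm (\<psi>
  x) + c1 - f 0\<close>; multiply by \<open>\<phi>0 x\<close> and integrate.\<close>

lemma G_coercive:
  assumes "\<psi> \<in> Linf_space \<mu>"
  shows "\<nu>1 * \<phi>0_low * L1_norm \<mu> \<psi> - coercivity_defect \<le> L2_inner \<mu> (G \<psi>) \<psi> - L2_inner \<mu> \<phi>1 \<psi>"
proof -
  have int: "integrable \<mu> (\<lambda>x. G \<psi> x \<bullet> \<psi> x)" "integrable \<mu> (\<lambda>x. \<phi>1 x \<bullet> \<psi> x)"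
    using integrable_G_inner[OF assms assms] \<phi>1_integrable[OF assms] by (simp_all add: inner_commute)
  then have eq: "L2_inner \<mu> (G \<psi>) \<psi> - L2_inner \<mu> \<phi>1 \<psi> = (LINT x|\<mu>. G \<psi> x \<bullet> \<psi> x - \<phi>1 x \<bullet> \<psi> x)"
    by (simp add: L2_inner_def)
  show ?thesis
  proof (cases "finite_measure \<mu>")
    case True
    have ints: "integrable \<mu> \<psi>" "integrable \<mu> \<phi>0"
      using Linf_space_integrable[OF True] assms \<phi>0_Linf by auto
    have "AE x in \<mu>. \<nu>1 * \<phi>0_low * norm (\<psi> x) - \<bar>f 0 - c1\<bar> * \<phi>0 x \<le> G \<psi> x \<bullet> \<psi> x - \<phi>1 x \<bullet> \<psi> x"
      using G_form[OF assms] \<phi>0_ge f_ge[OF assms]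
    proof eventually_elim
      case (elim x)
      have \<phi>0_pos: "\<phi>0 x \<ge> 0"
        using elim \<phi>0_low_pos by simp
      have "\<nu>1 * norm (\<psi> x) - \<bar>f 0 - c1\<bar> \<le> gradient f (\<psi> x) \<bullet> \<psi> x"
        using convex_gradient_ineq[OF f_convex f_diff, of "\<psi> x" 0] elim by simp
      then have "\<phi>0 x * (\<nu>1 * norm (\<psi> x) - \<bar>f 0 - c1\<bar>) \<le> \<phi>0 x * (gradient f (\<psi> x) \<bullet> \<psi> x)"
        using \<phi>0_pos by (rule mult_left_mono)
      moreover have "\<phi>0_low * (\<nu>1 * norm (\<psi> x)) \<le> \<phi>0 x * (\<nu>1 * norm (\<psi> x))"
        using elim \<nu>1_nonneg by (intro mult_right_mono) auto
      ultimately show ?case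
        using elim by (simp add: inner_add_left algebra_simps)
    qed
    then have "(LINT x|\<mu>. \<nu>1 * \<phi>0_low * norm (\<psi> x) - \<bar>f 0 - c1\<bar> * \<phi>0 x) \<le>
        (LINT x|\<mu>. G \<psi> x \<bullet> \<psi> x - \<phi>1 x \<bullet> \<psi> x)"
      using int ints by (intro integral_mono_AE) auto
    moreover have "(LINT x|\<mu>. \<nu>1 * \<phi>0_low * norm (\<psi> x) - \<bar>f 0 - c1\<bar> * \<phi>0 x) =
        \<nu>1 * \<phi>0_low * L1_norm \<mu> \<psi> - \<bar>f 0 - c1\<bar> * (LINT x|\<mu>. \<phi>0 x)"
      using ints by (simp add: L1_norm_def)
    moreover have "\<bar>f 0 - c1\<bar> * (LINT x|\<mu>. \<phi>0 x) \<le> coercivity_defect"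
      unfolding coercivity_defect_def by (intro mult_left_mono) auto
    ultimately show ?thesis
      unfolding eq by linarith
  next
    case False
    have "(LINT x|\<mu>. G \<psi> x \<bullet> \<psi> x - \<phi>1 x \<bullet> \<psi> x) = 0"
      by (rule integral_eq_zero_AE, use G_form[OF assms] in eventually_elim)
        (simp add: gradient_zero_if_infinite[OF False])
    then show ?thesis
      unfolding eq by (simp add: growth_zero_if_infinite[OF False] coercivity_defect_def)
  qed
qed

end

section \<open>Stability of the proximal Galerkin iterates\<close>

text \<open>\<open>Cstab\<close> is chosen before the mesh size, the step sizes and the iterates,
  with \<open>\<alpha>1\<close> fixed beforehand: this expresses independence of \<open>h\<close>,
  \<open>l\<close> and all step sizes but the first. The hidden constants for the Fortin operator
  and the initial guess are \<open>cF\<close> and \<open>c0\<close>.\<close>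

theorem theoremA1:
  fixes \<Omega> \<Omega>d :: "(real ^ 'n) set"
    and d :: real
    and \<mu> :: "(real ^ 'n) measure"
    and \<iota> :: "'q::{real_inner, complete_space} \<Rightarrow> real ^ 'n \<Rightarrow> real ^ 'm"
    and B :: "'v::{real_inner, complete_space} \<Rightarrow>\<^sub>L 'q"
    and C :: "real ^ 'n \<Rightarrow> (real ^ 'm) set"
    and a :: "'v \<Rightarrow> 'v \<Rightarrow> real"
    and F :: "'v \<Rightarrow>\<^sub>L real"
    and \<nu> Ma :: real
    and R :: "real ^ 'n \<Rightarrow> real ^ 'm \<Rightarrow> ereal"
    and \<phi>0 :: "real ^ 'n \<Rightarrow> real"
    and \<phi>0_low :: real
    and \<phi>1 :: 'q
    and R0s :: "real ^ 'm \<Rightarrow> real"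
    and \<nu>1 c1 :: real
    and Vh :: "real \<Rightarrow> 'v set"
    and Wh :: "real \<Rightarrow> (real ^ 'n \<Rightarrow> real ^ 'm) set"
    and \<beta>0 cF :: real
    and Ph :: "real \<Rightarrow> 'v \<Rightarrow> 'v"
    and \<alpha>1 c0 :: real
  assumes dim: "CARD('n) \<in> {1, 2, 3}"
    and \<Omega>: "polyhedral_domain \<Omega>"
    and \<Omega>d: "\<Omega>d \<subseteq> closure \<Omega>" "\<Omega>d \<in> sets (hausdorff_measure d)"
    and d: "hausdorff_dim \<Omega>d = d" "d \<le> real CARD('n)"
    and \<mu>: "\<mu> = restrict_space (hausdorff_measure d) \<Omega>d"
    and Q: "dense_embedding_L2 \<mu> \<iota>"
    and B: "surj (blinfun_apply B)"
    and C: "AE x in \<mu>. closed (C x) \<and> convex (C x) \<and> interior (C x) \<noteq> {}"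
    and a: "bilinear a" "\<And>u v. a u v = a v u"
      "\<And>u. a u u \<ge> \<nu> * (norm u)\<^sup>2" "\<And>u v. a u v \<le> Ma * norm u * norm v"
    and const: "\<nu> > 0" "Ma > 0"
    and W: "\<And>w. w \<in> Linf_space \<mu> \<Longrightarrow> is_functional_on \<mu> \<iota> w"
    and R: "Caratheodory_on \<mu> C R"
      "AE x in \<mu>. Legendre_function (R x) \<and> edom (R x) = C x \<and>
         ((\<lambda>y. R x y / ereal (norm y)) \<longlongrightarrow> \<infinity>) at_infinity"
    and R_cont: "continuous_map_between
        (\<lambda>f g. L2_norm \<mu> (\<lambda>x. f x - g x)) (admissible_set \<mu> C)
        (\<lambda>f g. L1_norm \<mu> (\<lambda>x. f x - g x)) (L1_space \<mu>) (superposition R)"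
    and Rs_cont: "continuous_map_between
        (\<lambda>f g. Linf_norm \<mu> (\<lambda>x. f x - g x)) (Linf_space \<mu>)
        (\<lambda>f g. L2_norm \<mu> (\<lambda>x. f x - g x)) (admissible_set \<mu> C) (grad_conjugate R)"
    and Vh: "\<And>h. h > 0 \<Longrightarrow> finite_dim_subspace (Vh h)"
    and Wh: "\<And>h. h > 0 \<Longrightarrow> finite_dim_subspace_Linf \<mu> (Wh h)"
    and inf_sup: "\<beta>0 > 0" "\<And>h. h > 0 \<Longrightarrow> inf_sup_constant \<mu> \<iota> B (Vh h) (Wh h) > ereal \<beta>0"
    and Fortin: "\<And>h. h > 0 \<Longrightarrow> Fortin_operator \<mu> \<iota> B (Vh h) (Wh h) cF (Ph h)"
    and R0s: "convex_on UNIV R0s" "\<And>z. R0s differentiable (at z)"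
    and form: "\<And>\<psi>. \<psi> \<in> Linf_space \<mu> \<Longrightarrow>
        AE x in \<mu>. grad_conjugate R \<psi> x = \<phi>0 x *\<^sub>R gradient R0s (\<psi> x) + \<iota> \<phi>1 x"
    and \<phi>0: "\<phi>0 \<in> Linf_space \<mu>" "AE x in \<mu>. \<phi>0 x \<ge> \<phi>0_low" "\<phi>0_low > 0"
    and lower: "\<nu>1 \<ge> 0" "\<And>\<psi>. \<psi> \<in> Linf_space \<mu> \<Longrightarrow> AE x in \<mu>. R0s (\<psi> x) - \<nu>1 * norm (\<psi> x) \<ge> c1"
    and \<alpha>1: "\<alpha>1 > 0"
  shows "\<exists>Cstab::real. \<forall>h>0. \<forall>\<alpha> u \<psi>.
      \<alpha> 1 = \<alpha>1 \<and> (\<forall>k\<ge>1. \<alpha> k > 0) \<and>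
      filterlim (\<lambda>n. \<Sum>k=1..n. \<alpha> k) at_top sequentially \<and>
      proximal_Galerkin_iterates \<mu> \<iota> B a F R (Vh h) (Wh h) \<alpha> u \<psi> \<and>
      norm (dual_adjoint B (to_dual \<mu> \<iota> (\<psi> 0))) \<le> c0 \<longrightarrow>
      (\<forall>l\<ge>1.
        \<nu> * norm (u l) + norm (to_dual \<mu> \<iota> (multiplier \<alpha> \<psi> l)) +
        (norm (to_dual \<mu> \<iota> (\<psi> l)) + \<nu>1 * \<phi>0_low * L1_norm \<mu> (\<psi> l)) / (\<Sum>k=1..l. \<alpha> k)
        \<le> Cstab)"
proof -
  interpret G: scaled_gradient \<mu> "grad_conjugate R" R0s \<phi>0 "\<iota> \<phi>1" \<phi>0_low \<nu>1 c1
  proof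
    show "grad_conjugate R \<psi> \<in> L2_space \<mu>" if "\<psi> \<in> Linf_space \<mu>" for \<psi>
      using Rs_cont that by (auto simp: continuous_map_between_def admissible_set_def)
    show "\<iota> \<phi>1 \<in> L2_space \<mu>"
      using Q by (simp add: dense_embedding_L2_def)
    show "integrable \<mu> (\<lambda>x. w x \<bullet> \<iota> \<phi>1 x)" if "w \<in> Linf_space \<mu>" for w
      using W[OF that] by (simp add: is_functional_on_def)
  qed (use form \<phi>0 R0s lower in auto)
  \<comment> \<open>The preimage is fixed before \<open>h\<close>, so \<open>P\<close> bounds all
    its Fortin images uniformly.\<close>
  obtain v1 where v1: "blinfun_apply B v1 = \<phi>1"
    using B by (metis surjD)
  define P where "P = cF * norm v1"
  define K where "K = G.coercivity_defect"
  define \<Lambda> where "\<Lambda> \<psi> k = to_dual \<mu> \<iota> (\<psi> k)" for \<psi> :: "nat \<Rightarrow> real ^ 'n \<Rightarrow> real ^ 'm" and k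
  define N where "N \<psi> k = \<nu>1 * \<phi>0_low * L1_norm \<mu> (\<psi> k)" for \<psi> :: "nat \<Rightarrow> real ^ 'n \<Rightarrow> real ^ 'm" and k
  have seq: "proximal_sequence a B F (Vh h) \<alpha> u (\<Lambda> \<psi>) (N \<psi>) (Ph h v1) \<nu> Ma \<beta>0 c0 K P \<alpha>1"
    and mult: "\<And>l. l \<ge> 1 \<Longrightarrow> to_dual \<mu> \<iota> (multiplier \<alpha> \<psi> l) = (1 / \<alpha> l) *\<^sub>R (\<Lambda> \<psi> (l - 1) - \<Lambda> \<psi> l)"
    if h: "h > 0" and \<alpha>: "\<forall>k\<ge>1. \<alpha> k > 0" "\<alpha> 1 = \<alpha>1"
      and it: "proximal_Galerkin_iterates \<mu> \<iota> B a F R (Vh h) (Wh h) \<alpha> u \<psi>"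
      and init: "norm (dual_adjoint B (to_dual \<mu> \<iota> (\<psi> 0))) \<le> c0"
    for h \<alpha> u \<psi>
  proof -
    have Wh_Linf: "w \<in> Linf_space \<mu>" if "w \<in> Wh h" for w
      using Wh[OF h] that by (auto simp: finite_dim_subspace_Linf_def)
    have fn: "is_functional_on \<mu> \<iota> w" if "w \<in> Wh h" for w
      using W Wh_Linf that by blast
    note Wh_diff = finite_dim_subspace_Linf_diff[OF Wh[OF h]]
    have \<psi>_in: "\<psi> k \<in> Wh h" for k
      using it by (cases k) (auto simp: proximal_Galerkin_iterates_def)
    have \<Lambda>_diff: "to_dual \<mu> \<iota> (\<lambda>x. \<psi> j x - \<psi> k x) = \<Lambda> \<psi> j - \<Lambda> \<psi> k" for j k
      unfolding \<Lambda>_def by (intro to_dual_diff fn Wh_diff \<psi>_in)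
    have constraint: "blinfun_apply (to_dual \<mu> \<iota> w) (blinfun_apply B (u k)) = L2_inner \<mu> (grad_conjugate R (\<psi> k)) w"
      if "k \<ge> 1" "w \<in> Wh h" for k w
      using it that bform_eq_to_dual[OF fn, of w B "u k"] by (auto simp: proximal_Galerkin_iterates_def)
    have Fort: "Fortin_operator \<mu> \<iota> B (Vh h) (Wh h) cF (Ph h)"
      by (rule Fortin[OF h])
    show "proximal_sequence a B F (Vh h) \<alpha> u (\<Lambda> \<psi>) (N \<psi>) (Ph h v1) \<nu> Ma \<beta>0 c0 K P \<alpha>1"
    proof
      show "subspace (Vh h)"
        using Vh[OF h] by (auto simp: finite_dim_subspace_def)
      show "Ph h v1 \<in> Vh h" "norm (Ph h v1) \<le> P"
        using Fort by (auto simp: Fortin_operator_def P_def)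
      show "K \<ge> 0"
        by (simp add: K_def G.coercivity_defect_def)
      show "u k \<in> Vh h" if "k \<ge> 1" for k
        using it that by (auto simp: proximal_Galerkin_iterates_def)
      show "\<alpha> k * a (u k) v + blinfun_apply (\<Lambda> \<psi> k - \<Lambda> \<psi> (k - 1)) (blinfun_apply B v) = \<alpha> k * blinfun_apply F v"
        if "k \<ge> 1" "v \<in> Vh h" for k v
        using it that bform_eq_to_dual[OF fn[OF Wh_diff[OF \<psi>_in[of k] \<psi>_in[of "k - 1"]]], of B v]
        unfolding proximal_Galerkin_iterates_def \<Lambda>_diff by metis
      \<comment> \<open>The constraints of steps \<open>k\<close> and \<open>k - 1\<close>, both
        tested with the latent increment, reduce this to \<open>G_monotone\<close>; the initial
        guess has no constraint, hence \<open>k \<ge> 2\<close>.\<close>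
      show "0 \<le> blinfun_apply (\<Lambda> \<psi> k - \<Lambda> \<psi> (k - 1)) (blinfun_apply B (u k - u (k - 1)))"
        if "k \<ge> 2" for k
        using G.G_monotone[OF Wh_Linf[OF \<psi>_in[of k]] Wh_Linf[OF \<psi>_in[of "k - 1"]]] that
          constraint[of k "\<lambda>x. \<psi> k x - \<psi> (k - 1) x"] constraint[of "k - 1" "\<lambda>x. \<psi> k x - \<psi> (k - 1) x"]
          Wh_diff[OF \<psi>_in[of k] \<psi>_in[of "k - 1"]]
        by (simp add: \<Lambda>_diff blinfun.diff_right)
      show "0 \<le> N \<psi> k" for k
        unfolding N_def using lower(1) \<phi>0(3) by (simp add: L1_norm_def)
      show "N \<psi> k - K \<le> blinfun_apply (\<Lambda> \<psi> k) (blinfun_apply B (u k - Ph h v1))" if "k \<ge> 1" for k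
      proof -
        \<comment> \<open>Against discrete functions the Fortin image may replace \<open>v1\<close>,
          so pairing with it reproduces \<open>\<phi>1\<close> and \<open>G_coercive\<close>
          applies.\<close>
        have "bform \<mu> \<iota> B (v1 - Ph h v1) (\<psi> k) = 0"
          using Fort \<psi>_in by (auto simp: Fortin_operator_def)
        then have "blinfun_apply (\<Lambda> \<psi> k) (blinfun_apply B (Ph h v1)) = L2_inner \<mu> (\<iota> \<phi>1) (\<psi> k)"
          using fn[OF \<psi>_in[of k]] v1
          by (simp add: \<Lambda>_def bform_eq_to_dual blinfun.diff_right to_dual_apply)
            (simp add: L2_inner_def inner_commute)
        then show ?thesis
          using G.G_coercive[OF Wh_Linf[OF \<psi>_in[of k]]] constraint[OF that \<psi>_in[of k]]
          by (simp add: N_def K_def \<Lambda>_def blinfun.diff_right)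
      qed
      show "norm (dual_adjoint B (\<Lambda> \<psi> 0)) \<le> c0"
        using init by (simp add: \<Lambda>_def)
      show "\<beta>0 * norm (\<Lambda> \<psi> 0) \<le> c"
        if "c \<ge> 0" "\<And>v. v \<in> Vh h \<Longrightarrow> blinfun_apply (\<Lambda> \<psi> 0) (blinfun_apply B v) \<le> c * norm v" for c
        using inf_sup_bound[OF inf_sup(2)[OF h] \<psi>_in fn[OF \<psi>_in] that(1)] that(2)
        by (simp add: \<Lambda>_def)
      \<comment> \<open>The inf-sup condition applies because the discrete space contains the latent
        increments.\<close>
      show "\<beta>0 * norm (\<Lambda> \<psi> (k - 1) - \<Lambda> \<psi> k) \<le> c"
        if "c \<ge> 0" "\<And>v. v \<in> Vh h \<Longrightarrow> blinfun_apply (\<Lambda> \<psi> (k - 1) - \<Lambda> \<psi> k) (blinfun_apply B v) \<le> c * norm v"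
        for k c
        using inf_sup_bound[OF inf_sup(2)[OF h] Wh_diff[OF \<psi>_in \<psi>_in] fn[OF Wh_diff[OF \<psi>_in \<psi>_in]] that(1),
            of "k - 1" k] that(2)
        by (simp add: \<Lambda>_diff)
    qed (use a const inf_sup \<alpha> in auto)
    show "to_dual \<mu> \<iota> (multiplier \<alpha> \<psi> l) = (1 / \<alpha> l) *\<^sub>R (\<Lambda> \<psi> (l - 1) - \<Lambda> \<psi> l)" for l
      using to_dual_scaleR[OF fn[OF Wh_diff[OF \<psi>_in \<psi>_in]], of "1 / \<alpha> l" "l - 1" l]
      by (simp add: \<Lambda>_diff multiplier_def[abs_def])
  qed
  show ?thesis
  proof (intro exI[of _ "proximal_sequence.stability_bound B F \<nu> Ma \<beta>0 c0 K P \<alpha>1"] allI impI, elim conjE)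
    fix h :: real and \<alpha> u \<psi> and l :: nat
    assume h: "h > 0" and \<alpha>: "\<forall>k\<ge>1. \<alpha> k > 0" "\<alpha> 1 = \<alpha>1"
      and it: "proximal_Galerkin_iterates \<mu> \<iota> B a F R (Vh h) (Wh h) \<alpha> u \<psi>"
      and init: "norm (dual_adjoint B (to_dual \<mu> \<iota> (\<psi> 0))) \<le> c0" and l: "l \<ge> 1"
    show "\<nu> * norm (u l) + norm (to_dual \<mu> \<iota> (multiplier \<alpha> \<psi> l)) +
        (norm (to_dual \<mu> \<iota> (\<psi> l)) + \<nu>1 * \<phi>0_low * L1_norm \<mu> (\<psi> l)) / (\<Sum>k=1..l. \<alpha> k)
        \<le> proximal_sequence.stability_bound B F \<nu> Ma \<beta>0 c0 K P \<alpha>1"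
      using proximal_sequence.stability[OF seq[OF h \<alpha> it init] l] mult[OF h \<alpha> it init l]
      by (simp add: \<Lambda>_def N_def)
  qed
qed

end
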